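(* Let $\mathcal{H}$ be a real Hilbert space, let $S\subseteq\mathcal{H}$ be a nonempty closed and convex set, and let $c\in\mathcal{H}$ be such that the maximum of $\langle c,x\rangle$ over $x\in S$ is attained. Let $x_0\in\mathcal{H}$, let $x^*$ be the unique point closest to $x_0$ in the set of maximizers $\mathcal{M}(c)=\operatorname{argmax}_{x\in S}\langle c,x\rangle$, and for $\eta\in\mathbb{R}$ let $x^\eta=P_S(x_0+\eta c)$. Then for every $\eta>0$, $$0\le\langle c,x^*\rangle-\langle c,x^\eta\rangle\le\frac{\|x^*-x_0\|^2-\|x^\eta-x_0\|^2}{2\eta}.$$
   Context: $\|\cdot\|$ denotes the norm induced by the inner product $\langle\cdot,\cdot\rangle$ of $\mathcal{H}$. The set of maximizers is $\mathcal{M}(c)=\{x\in S:\langle c,x\rangle\ge\langle c,z\rangle\ \text{for all } z\in S\}$; it is nonempty (standing assumption), closed and convex, so $x^*$ is well defined. For $x\in\mathcal{H}$, $P_S(x)$ denotes the orthogonal projection of $x$ onto $S$, i.e. the unique point of $S$ closest to $x$: $P_S(x)=\operatorname{argmin}_{y\in S}\|y-x\|$. *)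

theory Defs
  imports "HOL-Analysis.Analysis"
begin

definition maximizers :: "'a::real_inner set \<Rightarrow> 'a \<Rightarrow> 'a set" where
  "maximizers S c = {x \<in> S. \<forall>z\<in>S. inner c x \<ge> inner c z}"

(* The library constant closest_point requires the class heine_borel, which excludes
   infinite-dimensional Hilbert spaces.  The description below is meaningful only where the
   minimizer exists and is unique, e.g. for nonempty closed convex A in a Hilbert space. *)
definition proj :: "'a::real_inner set \<Rightarrow> 'a \<Rightarrow> 'a" where
  "proj A x = (THE y. is_arg_min (\<lambda>y. norm (y - x)) (\<lambda>y. y \<in> A) y)"

end

theory Submission
  imports Defs
begin

text \<open>
  Comparing the squared distances to \<open>x0 + \<eta> c\<close> of the projection \<open>x \<eta>\<close> and of the
  competitor \<open>xstar \<in> S\<close>, and expanding both, gives the upper bound: the terms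
  \<open>\<eta>\<^sup>2 \<parallel>c\<parallel>\<^sup>2\<close> cancel. That the projections exist in a Hilbert space follows
  from the parallelogram law, which makes the near-minimizing sets shrink to a point.
\<close>

text \<open>Parallelogram law for \<open>y - x\<close> and \<open>z - x\<close>: convexity puts the
  midpoint \<open>w\<close> in \<open>A\<close>, so the subtracted term
  \<open>4 * (norm (w - x))\<^sup>2\<close> is at least \<open>4 * D\<close>, leaving at most
  \<open>4 * e\<close>. Slack \<open>e > 0\<close> serves existence of closest points,
  \<open>e = 0\<close> their uniqueness.\<close>

lemma convex_dist_near_minimizers:
  fixes A :: "'a::real_inner set"
  assumes "convex A" "y \<in> A" "z \<in> A"
    and lower: "\<And>w. w \<in> A \<Longrightarrow> D \<le> (norm (w - x))\<^sup>2"
    and y: "(norm (y - x))\<^sup>2 \<le> D + e" and z: "(norm (z - x))\<^sup>2 \<le> D + e"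
  shows "(dist y z)\<^sup>2 \<le> 4 * e"
proof -
  define w where "w = (1/2) *\<^sub>R y + (1/2) *\<^sub>R z"
  have "w \<in> A"
    unfolding w_def using assms(1-3) by (intro convexD) auto
  have "2 *\<^sub>R (w - x) = (y - x) + (z - x)"
    unfolding w_def by (simp add: scaleR_right_distrib scaleR_right_diff_distrib scaleR_2)
  then have "(norm ((y - x) + (z - x)))\<^sup>2 = (norm (2 *\<^sub>R (w - x)))\<^sup>2"
    by (rule arg_cong[where f = "\<lambda>v. (norm v)\<^sup>2", symmetric])
  also have "\<dots> = 4 * (norm (w - x))\<^sup>2"
    by (simp add: power_mult_distrib del: scaleR_diff_right)
  finally have "(norm ((y - x) + (z - x)))\<^sup>2 = 4 * (norm (w - x))\<^sup>2" .
  moreover have "(dist y z)\<^sup>2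
      = 2 * (norm (y - x))\<^sup>2 + 2 * (norm (z - x))\<^sup>2 - (norm ((y - x) + (z - x)))\<^sup>2"
    unfolding dist_norm power2_norm_eq_inner
    by (simp add: inner_diff_left inner_diff_right inner_add_left inner_add_right inner_commute)
  ultimately have "(dist y z)\<^sup>2
      = 2 * (norm (y - x))\<^sup>2 + 2 * (norm (z - x))\<^sup>2 - 4 * (norm (w - x))\<^sup>2"
    by simp
  with lower[OF \<open>w \<in> A\<close>] y z show ?thesis by linarith
qed

text \<open>Completeness enters through Cantor's intersection theorem: the sets \<open>F n\<close>
  of near-minimizers are closed, nonempty and nested, with diameters tending to 0, so they share a
  point, and this point attains the infimum.\<close>

lemma closest_point_exists:
  fixes A :: "'a::{real_inner,complete_space} set"
  assumes "A \<noteq> {}" "closed A" "convex A"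
  shows "\<exists>y. is_arg_min (\<lambda>y. norm (y - x)) (\<lambda>y. y \<in> A) y"
proof -
  define D where "D = (INF y\<in>A. (norm (y - x))\<^sup>2)"
  define F where "F n = {y \<in> A. (norm (y - x))\<^sup>2 \<le> D + inverse (real (Suc n))}" for n
  have bdd: "bdd_below ((\<lambda>y. (norm (y - x))\<^sup>2) ` A)"
    by (rule bdd_belowI[of _ 0]) auto
  have lower: "D \<le> (norm (w - x))\<^sup>2" if "w \<in> A" for w
    unfolding D_def using bdd that by (rule cINF_lower)
  have "\<exists>a. \<forall>n. a \<in> F n"
  proof (rule decreasing_closed_nest[of F])
    show "closed (F n)" for n
      unfolding F_def using \<open>closed A\<close>
      by (intro closed_Collect_conj closed_Collect_le continuous_intros) simp
    show "F n \<noteq> {}" for n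
    proof -
      obtain y where "y \<in> A" "(norm (y - x))\<^sup>2 < D + inverse (real (Suc n))"
        using cINF_less_iff[OF \<open>A \<noteq> {}\<close> bdd, of "D + inverse (real (Suc n))"]
        by (auto simp: D_def)
      then show ?thesis unfolding F_def by (auto intro: less_imp_le)
    qed
    show "F n \<subseteq> F m" if "m \<le> n" for m n
    proof -
      have "D + inverse (real (Suc n)) \<le> D + inverse (real (Suc m))"
        using that by (simp add: le_imp_inverse_le)
      from order_trans[OF _ this] show ?thesis unfolding F_def by blast
    qed
    show "\<exists>n. \<forall>y\<in>F n. \<forall>z\<in>F n. dist y z < e" if "e > 0" for e
    proof -
      \<comment> \<open>The factor 1/4 absorbs the 4 in the parallelogram bound, so that squared
        distances within \<open>F n\<close> stay below \<open>e\<^sup>2\<close>.\<close>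
      obtain n where n: "inverse (real (Suc n)) < e\<^sup>2 / 4"
        using reals_Archimedean[of "e\<^sup>2 / 4"] \<open>e > 0\<close> by auto
      have "dist y z < e" if "y \<in> F n" "z \<in> F n" for y z
      proof -
        have "(dist y z)\<^sup>2 \<le> 4 * inverse (real (Suc n))"
          using that lower
          by (intro convex_dist_near_minimizers[OF \<open>convex A\<close>]) (auto simp: F_def)
        with n have "(dist y z)\<^sup>2 < e\<^sup>2" by linarith
        then show ?thesis using \<open>e > 0\<close> by (simp add: power_less_imp_less_base)
      qed
      then show ?thesis by blast
    qed
  qed blast
  then obtain a where a: "\<And>n. a \<in> F n" by blast
  \<comment> \<open>The point \<open>a\<close> satisfies the bound of every \<open>F n\<close>;
    letting the slack tend to 0 leaves the infimum \<open>D\<close> itself.\<close>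
  have "(norm (a - x))\<^sup>2 \<le> D"
  proof (rule field_le_epsilon)
    fix e :: real assume "e > 0"
    then obtain n where "inverse (real (Suc n)) < e" using reals_Archimedean by blast
    with a[of n] show "(norm (a - x))\<^sup>2 \<le> D + e" unfolding F_def by auto
  qed
  then have "norm (a - x) \<le> norm (w - x)" if "w \<in> A" for w
    using lower[OF that] by (simp add: power2_le_imp_le)
  with a[of 0] show ?thesis
    by (auto simp: is_arg_min_linorder F_def)
qed

text \<open>Unique existence is what gives the definite description in \<open>proj\<close> its
  meaning; afterwards \<open>proj\<close> is used only through its minimality.\<close>

lemma proj_is_arg_min:
  fixes A :: "'a::{real_inner,complete_space} set"
  assumes "A \<noteq> {}" "closed A" "convex A"
  shows "is_arg_min (\<lambda>y. norm (y - x)) (\<lambda>y. y \<in> A) (proj A x)"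
  unfolding proj_def
proof (rule theI')
  have "y = z"
    if y: "is_arg_min (\<lambda>y. norm (y - x)) (\<lambda>y. y \<in> A) y"
      and z: "is_arg_min (\<lambda>y. norm (y - x)) (\<lambda>y. y \<in> A) z" for y z
  proof -
    \<comment> \<open>Two exact minimizers are near-minimizers with slack 0, taking their common
      squared distance to \<open>x\<close> as the lower bound \<open>D\<close>.\<close>
    have "(dist y z)\<^sup>2 \<le> 4 * 0"
      using y z
      by (intro convex_dist_near_minimizers[OF \<open>convex A\<close>, where D = "(norm (y - x))\<^sup>2" and x = x])
        (auto simp: is_arg_min_linorder)
    then show ?thesis by simp
  qed
  with closest_point_exists[OF assms]
  show "\<exists>!y. is_arg_min (\<lambda>y. norm (y - x)) (\<lambda>y. y \<in> A) y"
    by (rule ex_ex1I)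
qed

lemma
  fixes A :: "'a::{real_inner,complete_space} set"
  assumes "A \<noteq> {}" "closed A" "convex A"
  shows proj_in: "proj A x \<in> A"
    and norm_proj_le: "y \<in> A \<Longrightarrow> norm (proj A x - x) \<le> norm (y - x)"
  using proj_is_arg_min[OF assms, of x] by (auto simp: is_arg_min_linorder)

text \<open>Each comparison with a fixed \<open>z\<close> cuts out a closed half-space, so
  closedness and convexity of \<open>S\<close> pass to the set of maximizers by
  intersection.\<close>

lemma maximizers_eq_Int: "maximizers S c = S \<inter> (\<Inter>z\<in>S. {y. inner c z \<le> inner c y})"
  by (auto simp: maximizers_def)

lemma closed_maximizers: "closed S \<Longrightarrow> closed (maximizers S c)"
  unfolding maximizers_eq_Int
  by (intro closed_Int closed_INT ballI closed_Collect_le continuous_intros)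

lemma convex_maximizers: "convex S \<Longrightarrow> convex (maximizers S c)"
  unfolding maximizers_eq_Int
  by (intro convex_Int convex_INT convex_halfspace_ge)
    (simp_all add: convex_halfspace_ge)

theorem lemma2p4:
  fixes S :: "'a::{real_inner,complete_space} set"
    and c x0 xstar :: 'a
    and x :: "real \<Rightarrow> 'a"
  assumes "S \<noteq> {}" and "closed S" and "convex S"
    and "maximizers S c \<noteq> {}"
    and "xstar = proj (maximizers S c) x0"
    and "\<And>\<eta>. x \<eta> = proj S (x0 + \<eta> *\<^sub>R c)"
  shows "\<forall>\<eta>>0. 0 \<le> inner c xstar - inner c (x \<eta>) \<and>
           inner c xstar - inner c (x \<eta>)
             \<le> ((norm (xstar - x0))\<^sup>2 - (norm (x \<eta> - x0))\<^sup>2) / (2 * \<eta>)"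
proof (intro allI impI)
  fix \<eta> :: real assume "\<eta> > 0"
  \<comment> \<open>The set of maximizers is itself nonempty, closed and convex, so its projection
    of \<open>x0\<close> exists and lies in it.\<close>
  have xstar: "xstar \<in> maximizers S c"
    using assms by (simp add: proj_in closed_maximizers convex_maximizers)
  then have "xstar \<in> S" by (simp add: maximizers_def)
  have "x \<eta> \<in> S" using assms by (simp add: proj_in)
  \<comment> \<open>Regrouping as \<open>(y - x0) - \<eta> *\<^sub>R c\<close> isolates the
    dependence on \<open>y\<close>; only the last term is the same for both points compared.\<close>
  have expand: "(norm (y - (x0 + \<eta> *\<^sub>R c)))\<^sup>2
      = (norm (y - x0))\<^sup>2 - 2 * \<eta> * inner c (y - x0) + (norm (\<eta> *\<^sub>R c))\<^sup>2" for y
    unfolding diff_diff_eq[symmetric] power2_norm_eq_inner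
    by (simp add: inner_commute algebra_simps)
  have "norm (x \<eta> - (x0 + \<eta> *\<^sub>R c)) \<le> norm (xstar - (x0 + \<eta> *\<^sub>R c))"
    unfolding assms(6) using assms(1-3) \<open>xstar \<in> S\<close> by (rule norm_proj_le)
  then have "(norm (x \<eta> - (x0 + \<eta> *\<^sub>R c)))\<^sup>2 \<le> (norm (xstar - (x0 + \<eta> *\<^sub>R c)))\<^sup>2"
    by (simp add: power_mono)
  then have "(inner c xstar - inner c (x \<eta>)) * (2 * \<eta>)
      \<le> (norm (xstar - x0))\<^sup>2 - (norm (x \<eta> - x0))\<^sup>2"
    unfolding expand by (simp add: algebra_simps)
  then have "inner c xstar - inner c (x \<eta>)
      \<le> ((norm (xstar - x0))\<^sup>2 - (norm (x \<eta> - x0))\<^sup>2) / (2 * \<eta>)"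
    using \<open>\<eta> > 0\<close> by (simp add: pos_le_divide_eq)
  \<comment> \<open>The lower bound is just optimality of \<open>xstar\<close> over
    \<open>S\<close>, tested at the feasible point \<open>x \<eta>\<close>.\<close>
  moreover have "0 \<le> inner c xstar - inner c (x \<eta>)"
    using xstar \<open>x \<eta> \<in> S\<close> by (simp add: maximizers_def)
  ultimately show "0 \<le> inner c xstar - inner c (x \<eta>) \<and> inner c xstar - inner c (x \<eta>)
      \<le> ((norm (xstar - x0))\<^sup>2 - (norm (x \<eta> - x0))\<^sup>2) / (2 * \<eta>)"
    by blast
qed

end
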